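(* Let $(X,r)$ be a right non-degenerate solution and let $\kappa:X\to X$ be a $\rho$-invariant map for $(X,r)$. Then $\kappa$ is a reflection for $(X,r)$ if and only if $\kappa$ is a reflection for the right derived solution $(X,r_\triangleleft)$ of $(X,r)$.
   Context: A (set-theoretic) solution (of the Yang-Baxter equation) is a pair $(X,r)$ with $X$ a set and $r:X\times X\to X\times X$ a map satisfying $(r\times \mathrm{id}_X)(\mathrm{id}_X\times r)(r\times \mathrm{id}_X)=(\mathrm{id}_X\times r)(r\times \mathrm{id}_X)(\mathrm{id}_X\times r)$. Write $r(x,y)=(\lambda_x(y),\rho_y(x))$. The solution is right non-degenerate if every $\rho_x:X\to X$ is bijective. A reflection for $(X,r)$ is a map $\kappa:X\to X$ with $r(\mathrm{id}_X\times\kappa)r(\mathrm{id}_X\times\kappa)=(\mathrm{id}_X\times\kappa)r(\mathrm{id}_X\times\kappa)r$. A map $\kappa:X\to X$ is $\rho$-invariant for $(X,r)$ if $\rho_{\kappa(x)}=\rho_x$ for all $x\in X$. If $(X,r)$ is right non-degenerate, its associated right shelf is $(X,\triangleleft_r)$ with $x\triangleleft_r y:=\rho_y\lambda_{\rho_x^{-1}(y)}(x)$ (a right self-distributive operation). The right derived solution of $(X,r)$ is the solution $(X,r_\triangleleft)$ given by $r_\triangleleft(x,y)=(y\triangleleft_r x,\,x)$ for all $x,y\in X$. *)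

theory Defs
  imports Main "HOL-Library.FuncSet"
begin

text \<open>
  A set \<open>X\<close> is a carrier set \<open>X :: 'a set\<close>, possibly empty. Maps are HOL functions
  that send the carrier into the carrier; their values off the carrier play no role,
  so equations between maps are required on the carrier only.
\<close>

definition lam :: "('a \<times> 'a \<Rightarrow> 'a \<times> 'a) \<Rightarrow> 'a \<Rightarrow> 'a \<Rightarrow> 'a" where
  "lam r x y = fst (r (x, y))"

text \<open>The subscript comes first: \<open>rho r y x\<close> is \<open>\<rho>\<^sub>y(x)\<close>, so \<open>r (x, y) = (lam r x y, rho r y x)\<close>.\<close>

definition rho :: "('a \<times> 'a \<Rightarrow> 'a \<times> 'a) \<Rightarrow> 'a \<Rightarrow> 'a \<Rightarrow> 'a" where
  "rho r y x = snd (r (x, y))"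

text \<open>Triples are nested to the right, so \<open>r \<times> id\<close> needs reassociation.\<close>

definition r12 :: "('a \<times> 'a \<Rightarrow> 'a \<times> 'a) \<Rightarrow> 'a \<times> 'a \<times> 'a \<Rightarrow> 'a \<times> 'a \<times> 'a" where
  "r12 r = (\<lambda>(x, y, z). case r (x, y) of (u, v) \<Rightarrow> (u, v, z))"

definition r23 :: "('a \<times> 'a \<Rightarrow> 'a \<times> 'a) \<Rightarrow> 'a \<times> 'a \<times> 'a \<Rightarrow> 'a \<times> 'a \<times> 'a" where
  "r23 r = map_prod id r"

definition ybe_solution :: "'a set \<Rightarrow> ('a \<times> 'a \<Rightarrow> 'a \<times> 'a) \<Rightarrow> bool" where
  "ybe_solution X r \<longleftrightarrow>
     r \<in> X \<times> X \<rightarrow> X \<times> X \<and>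
     (\<forall>t \<in> X \<times> X \<times> X. (r12 r \<circ> r23 r \<circ> r12 r) t = (r23 r \<circ> r12 r \<circ> r23 r) t)"

definition right_nondegenerate :: "'a set \<Rightarrow> ('a \<times> 'a \<Rightarrow> 'a \<times> 'a) \<Rightarrow> bool" where
  "right_nondegenerate X r \<longleftrightarrow> (\<forall>x \<in> X. bij_betw (rho r x) X X)"

definition reflection :: "'a set \<Rightarrow> ('a \<times> 'a \<Rightarrow> 'a \<times> 'a) \<Rightarrow> ('a \<Rightarrow> 'a) \<Rightarrow> bool" where
  "reflection X r \<kappa> \<longleftrightarrow>
     \<kappa> \<in> X \<rightarrow> X \<and>
     (\<forall>p \<in> X \<times> X. (r \<circ> map_prod id \<kappa> \<circ> r \<circ> map_prod id \<kappa>) p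
                 = (map_prod id \<kappa> \<circ> r \<circ> map_prod id \<kappa> \<circ> r) p)"

definition rho_invariant :: "'a set \<Rightarrow> ('a \<times> 'a \<Rightarrow> 'a \<times> 'a) \<Rightarrow> ('a \<Rightarrow> 'a) \<Rightarrow> bool" where
  "rho_invariant X r \<kappa> \<longleftrightarrow>
     \<kappa> \<in> X \<rightarrow> X \<and> (\<forall>x \<in> X. \<forall>y \<in> X. rho r (\<kappa> x) y = rho r x y)"

definition right_shelf :: "'a set \<Rightarrow> ('a \<times> 'a \<Rightarrow> 'a \<times> 'a) \<Rightarrow> 'a \<Rightarrow> 'a \<Rightarrow> 'a" where
  "right_shelf X r x y = rho r y (lam r (inv_into X (rho r x) y) x)"

definition right_derived :: "'a set \<Rightarrow> ('a \<times> 'a \<Rightarrow> 'a \<times> 'a) \<Rightarrow> 'a \<times> 'a \<Rightarrow> 'a \<times> 'a" where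
  "right_derived X r = (\<lambda>(x, y). (right_shelf X r y x, x))"

end

theory Submission
  imports Defs
begin

text \<open>
  Write \<open>\<lambda>\<^sub>x(y)\<close>, \<open>\<rho>\<^sub>y(x)\<close> for the components of \<open>r (x, y)\<close> and \<open>\<triangleleft>\<close> for the associated right shelf.
  Fix the second entry \<open>y\<close> of a pair \<open>(x, y)\<close> and replace the first one by \<open>w = \<rho>\<^sub>y(x)\<close>.  As
  \<open>\<rho>\<^sub>y\<close> is a bijection, the pairs \<open>(y, w)\<close> run through \<open>X \<times> X\<close> as well, and by definition of the shelf
  \<open>\<rho>\<^sub>w(\<lambda>\<^sub>x(y)) = y \<triangleleft> w\<close>.  Since \<open>\<kappa>\<close> is \<open>\<rho>\<close>-invariant, also \<open>\<rho>\<^sub>w(\<lambda>\<^sub>x(\<kappa> y)) = \<kappa> y \<triangleleft> w\<close> with the same \<open>x\<close>.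

  Compare the two components of the reflection equation at \<open>(x, y)\<close>.  The second one reads
  \<open>\<kappa> y \<triangleleft> w = \<kappa> (y \<triangleleft> w)\<close>.  The first one equates two elements whose images under \<open>\<rho>\<close> with
  subscripts \<open>\<kappa> y \<triangleleft> w\<close> and \<open>y \<triangleleft> w\<close> are \<open>\<kappa> w \<triangleleft> (\<kappa> y \<triangleleft> w)\<close> and \<open>\<kappa> w \<triangleleft> (y \<triangleleft> w)\<close>; given the second
  component, the subscripts differ by an application of \<open>\<kappa>\<close>, so the two maps are one and the same
  injection, and the first component amounts to \<open>\<kappa> w \<triangleleft> (\<kappa> y \<triangleleft> w) = \<kappa> w \<triangleleft> (y \<triangleleft> w)\<close>.  These two shelf
  equations are the reflection equation of the derived solution at \<open>(w, y)\<close>.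
\<close>

lemma lam_in:
  assumes "r \<in> X \<times> X \<rightarrow> X \<times> X" "x \<in> X" "y \<in> X"
  shows "lam r x y \<in> X"
  using assms by (force simp: lam_def Pi_iff mem_Times_iff)

lemma rho_in:
  assumes "r \<in> X \<times> X \<rightarrow> X \<times> X" "x \<in> X" "y \<in> X"
  shows "rho r y x \<in> X"
  using assms by (force simp: rho_def Pi_iff mem_Times_iff)

text \<open>
  Substituting \<open>\<rho>\<^sub>y(x)\<close> for the second argument cancels the inverse in the definition of the shelf,
  which then no longer enters the proof.
\<close>

lemma right_shelf_rho:
  assumes "right_nondegenerate X r" "x \<in> X" "y \<in> X"
  shows "right_shelf X r y (rho r y x) = rho r (rho r y x) (lam r x y)"
proof -
  have "inj_on (rho r y) X"
    using assms by (auto simp: right_nondegenerate_def bij_betw_def)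
  then show ?thesis
    using assms by (simp add: right_shelf_def inv_into_f_f)
qed

lemma right_shelf_in:
  assumes "r \<in> X \<times> X \<rightarrow> X \<times> X" "right_nondegenerate X r" "y \<in> X" "w \<in> X"
  shows "right_shelf X r y w \<in> X"
proof -
  have "w \<in> rho r y ` X"
    using assms by (simp add: right_nondegenerate_def bij_betw_def)
  then obtain x where "x \<in> X" "w = rho r y x"
    by blast
  then show ?thesis
    using assms by (simp add: right_shelf_rho lam_in rho_in)
qed

lemma rho_invariant_rho_eq:
  "\<lbrakk>rho_invariant X r \<kappa>; x \<in> X; y \<in> X\<rbrakk> \<Longrightarrow> rho r (\<kappa> x) y = rho r x y"
  by (simp add: rho_invariant_def)

lemma rho_invariant_in: "\<lbrakk>rho_invariant X r \<kappa>; x \<in> X\<rbrakk> \<Longrightarrow> \<kappa> x \<in> X"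
  by (auto simp: rho_invariant_def)

lemma reflection_iff_components:
  "reflection X r \<kappa> \<longleftrightarrow> \<kappa> \<in> X \<rightarrow> X \<and>
     (\<forall>x\<in>X. \<forall>y\<in>X.
        lam r (lam r x (\<kappa> y)) (\<kappa> (rho r (\<kappa> y) x)) = lam r (lam r x y) (\<kappa> (rho r y x)) \<and>
        rho r (\<kappa> (rho r (\<kappa> y) x)) (lam r x (\<kappa> y)) = \<kappa> (rho r (\<kappa> (rho r y x)) (lam r x y)))"
  by (auto simp: reflection_def lam_def rho_def map_prod_def split_beta prod_eq_iff)

lemma reflection_right_derived_iff:
  "reflection X (right_derived X r) \<kappa> \<longleftrightarrow> \<kappa> \<in> X \<rightarrow> X \<and>
     (\<forall>w\<in>X. \<forall>y\<in>X.
        right_shelf X r (\<kappa> w) (right_shelf X r (\<kappa> y) w)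
          = right_shelf X r (\<kappa> w) (right_shelf X r y w) \<and>
        right_shelf X r (\<kappa> y) w = \<kappa> (right_shelf X r y w))"
  by (auto simp: reflection_def right_derived_def)

text \<open>
  The change of variables \<open>w = \<rho>\<^sub>y(x)\<close> at a single pair.
\<close>

lemma reflection_equation_at_iff:
  assumes r: "r \<in> X \<times> X \<rightarrow> X \<times> X"
    and nd: "right_nondegenerate X r"
    and inv: "rho_invariant X r \<kappa>"
    and x: "x \<in> X" and y: "y \<in> X"
    and w: "w = rho r y x"
  shows
    "lam r (lam r x (\<kappa> y)) (\<kappa> (rho r (\<kappa> y) x)) = lam r (lam r x y) (\<kappa> (rho r y x)) \<and>
     rho r (\<kappa> (rho r (\<kappa> y) x)) (lam r x (\<kappa> y)) = \<kappa> (rho r (\<kappa> (rho r y x)) (lam r x y))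
     \<longleftrightarrow>
     right_shelf X r (\<kappa> w) (right_shelf X r (\<kappa> y) w)
       = right_shelf X r (\<kappa> w) (right_shelf X r y w) \<and>
     right_shelf X r (\<kappa> y) w = \<kappa> (right_shelf X r y w)"
    (is "?L1 \<and> ?L2 \<longleftrightarrow> ?D1 \<and> ?D2")
proof -
  define a where "a = lam r x (\<kappa> y)"
  define b where "b = lam r x y"
  define v where "v = right_shelf X r y w"
  have \<kappa>y: "\<kappa> y \<in> X" using inv y by (rule rho_invariant_in)
  have wX: "w \<in> X" using r x y by (simp add: w rho_in)
  have \<kappa>w: "\<kappa> w \<in> X" using inv wX by (rule rho_invariant_in)
  have a: "a \<in> X" and b: "b \<in> X"
    using r x y \<kappa>y by (auto simp: a_def b_def lam_in)
  have v: "v \<in> X" unfolding v_def using r nd y wX by (rule right_shelf_in)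
  have w': "rho r (\<kappa> y) x = w"
    using rho_invariant_rho_eq[OF inv y x] by (simp add: w)
  have shelf_a: "right_shelf X r (\<kappa> y) w = rho r w a"
    using right_shelf_rho[OF nd x \<kappa>y] by (simp add: w' a_def)
  have shelf_b: "v = rho r w b"
    using right_shelf_rho[OF nd x y] by (simp add: v_def b_def w)
  have \<rho>a: "rho r (\<kappa> w) a = rho r w a" and \<rho>b: "rho r (\<kappa> w) b = rho r w b"
    using rho_invariant_rho_eq[OF inv wX] a b by auto
  have second: "?L2 \<longleftrightarrow> ?D2"
    by (simp add: w' w[symmetric] a_def[symmetric] b_def[symmetric] v_def[symmetric]
        shelf_a shelf_b \<rho>a \<rho>b)
  have first: "?L1 \<longleftrightarrow> ?D1" if ?D2
  proof -
    have \<rho>wa: "rho r w a = \<kappa> v"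
      using that shelf_a by (simp add: v_def)
    (* by invariance, the subscript kappa v may be replaced by v, so that A and B
       express both shelf products through the same injection *)
    have A: "right_shelf X r (\<kappa> w) (\<kappa> v) = rho r v (lam r a (\<kappa> w))"
      using right_shelf_rho[OF nd a \<kappa>w] rho_invariant_rho_eq[OF inv v lam_in[OF r a \<kappa>w]]
      by (simp add: \<rho>a \<rho>wa)
    have B: "right_shelf X r (\<kappa> w) v = rho r v (lam r b (\<kappa> w))"
      using right_shelf_rho[OF nd b \<kappa>w] by (simp add: \<rho>b shelf_b)
    have "inj_on (rho r v) X"
      using nd v by (auto simp: right_nondegenerate_def bij_betw_def)
    then have "rho r v (lam r a (\<kappa> w)) = rho r v (lam r b (\<kappa> w))
                 \<longleftrightarrow> lam r a (\<kappa> w) = lam r b (\<kappa> w)"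
      using lam_in[OF r a \<kappa>w] lam_in[OF r b \<kappa>w] by (rule inj_on_eq_iff)
    then show ?thesis
      using A B \<rho>wa
      by (simp add: w' w[symmetric] a_def[symmetric] b_def[symmetric] v_def[symmetric] shelf_a)
  qed
  from first second show ?thesis by blast
qed

theorem corollary3p3:
  fixes X :: "'a set" and r :: "'a \<times> 'a \<Rightarrow> 'a \<times> 'a" and \<kappa> :: "'a \<Rightarrow> 'a"
  assumes "ybe_solution X r"
    and "right_nondegenerate X r"
    and "rho_invariant X r \<kappa>"
  shows "reflection X r \<kappa> \<longleftrightarrow> reflection X (right_derived X r) \<kappa>"
proof -
  have r: "r \<in> X \<times> X \<rightarrow> X \<times> X"
    using assms(1) by (simp add: ybe_solution_def)
  have onto: "rho r y ` X = X" if "y \<in> X" for y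
    using assms(2) that by (auto simp: right_nondegenerate_def bij_betw_def)
  define D where "D = (\<lambda>w y. right_shelf X r (\<kappa> w) (right_shelf X r (\<kappa> y) w)
       = right_shelf X r (\<kappa> w) (right_shelf X r y w) \<and>
     right_shelf X r (\<kappa> y) w = \<kappa> (right_shelf X r y w))"
  have "reflection X r \<kappa> \<longleftrightarrow> \<kappa> \<in> X \<rightarrow> X \<and> (\<forall>x\<in>X. \<forall>y\<in>X. D (rho r y x) y)"
    unfolding reflection_iff_components D_def
    using reflection_equation_at_iff[OF r assms(2,3) _ _ refl] by simp
  also have "\<dots> \<longleftrightarrow> \<kappa> \<in> X \<rightarrow> X \<and> (\<forall>y\<in>X. \<forall>w\<in>rho r y ` X. D w y)"
    by blast
  also have "\<dots> \<longleftrightarrow> \<kappa> \<in> X \<rightarrow> X \<and> (\<forall>w\<in>X. \<forall>y\<in>X. D w y)"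
    using onto by auto
  also have "\<dots> \<longleftrightarrow> reflection X (right_derived X r) \<kappa>"
    unfolding reflection_right_derived_iff D_def ..
  finally show ?thesis .
qed

end
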